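(* Let $p=p(x,t;y)$, $x\in D$, $y\in\Omega$, be the exact solution, let $p_h^{y}$ be the numerical solution which is exact in the $x$ variable and discretized in $y$, and let $p_h^{xy}=\{p_{ik}^n\}$ be the SFV-cluster solution discretized in both variables; let $\mathbb{E}[p]$, $\mathbb{V}[p]$ be the exact mean and variance and $E_h[p_h^{xy}]$, $V_h[p_h^{xy}]$ their SFV-cluster approximations, computed with cell weights $\tilde\alpha_k$ obtained from $N$ samples and $N_y$ clusters (all as defined in the context). Assume that $$\|p_h^{y}-p_h^{xy}\|_{L^1(D)}\leqslant C_1\Delta x^{q}\quad\text{for all } y\in\Omega,\qquad \|p-p_h^{y}\|_{L^1(\Omega)}\leqslant C_2\Delta y^{r}\quad\text{for all } x\in D,$$ and that the Monte Carlo weight error satisfies $|\alpha_k-\tilde\alpha_k|\lesssim\sigma_k/\sqrt N$ for every $k=1,\dots,N_y$. Put $\sigma=\max_{1\le k\le N_y}\sigma_k$. Then there are constants $C,C_3,C_1',C',C_3'$ such that $$\|\mathbb{E}[p]-E_h[p_h^{xy}]\|_{L^1(D)}\leqslant C_1\Delta x^{q}+C\Delta y^{r}+C_3\frac{\sigma}{\sqrt N},$$ $$\|\mathbb{V}[p]-V_h[p_h^{xy}]\|_{L^1(D)}\leqslant C_1'\Delta x^{q}+C'\Delta y^{r}+C_3'\frac{\sigma}{\sqrt N}.$$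
   Context: Setting. $D$ is the physical domain, of measure $|D|$, partitioned into cells $\Delta x_i$ with centers $x_i$ and mesh size $\Delta x$. $\Omega$ is the parameter space, and the random parameter $y\in\Omega$ has probability density $\rho$, with associated probability measure $P$. The sets $\omega_1,\dots,\omega_{N_y}$ (clusters, regarded as cells) partition $\Omega$ up to null sets: $P(\omega_j\cap\omega_k)=0$ for $j\ne k$ and $\Omega=\bigcup_{k=1}^{N_y}\omega_k$. $\Delta y$ denotes the largest radius of the clusters. $N_y$ is the number of clusters. The exponents $q,r$ are the orders of the scheme in the physical and parameter variables. Approximation. At a time level $t=t^n$, $p_{ik}^n$ is the approximate value of $p$ in physical cell $i$ and parameter cell $\omega_k$; $p_h^{xy}=\{p_{ik}^n\}$ is identified with the function on $D\times\Omega$ equal to $p_{ik}^n$ on $\Delta x_i\times\omega_k$. The function $p_h^{y}$ is the semi-discrete solution, discretized only in $y$ (over the cells $\omega_k$) and exact in $x$. Exact mean and variance: $$\mathbb{E}[p](x_i,t^n)=\int_\Omega p(x_i,t^n;y)\rho(y)\,dy,\qquad \mathbb{V}[p](x_i,t^n)=\mathbb{E}[p^2](x_i,t^n)-\big(\mathbb{E}[p](x_i,t^n)\big)^2 .$$ Weights: let $y_1,\dots,y_N$ be $N$ Monte Carlo samples of $y$ and $$\alpha_k=\int_{\omega_k}\rho(y)\,dy,\qquad \tilde\alpha_k=\frac1N\sum_{j=1}^N \mathbf 1(y_j\in\omega_k).$$ $\sigma_k$ is the standard deviation of the random variable $\mathbf 1(y\in\omega_k)$. SFV-cluster mean and variance: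 $$E_h[p_h^{xy}]_i^n=\sum_{k=1}^{N_y}p_{ik}^n\tilde\alpha_k,\qquad V_h[p_h^{xy}]_i^n=E_h[(p_h^{xy})^2]_i^n-\big(E_h[p_h^{xy}]_i^n\big)^2,\qquad E_h[(p_h^{xy})^2]_i^n=\sum_{k=1}^{N_y}(p_{ik}^n)^2\tilde\alpha_k .$$ Norms over $D$ compare these quantities in physical space (values at $x_i$, i.e. on cell $i$) at a time level $t^n$. The notation $a\lesssim b$ means $a\le c\,b$ with a constant $c$ independent of $\Delta x,\Delta y,N,N_y$. The constants $C_1,C_2,C,C_3,C_1',C',C_3'$ are independent of $\Delta x,\Delta y,N,N_y$ except that they may depend on norms of $p$, $p_h^{y}$ and $p_h^{xy}$; they may also depend on $\sup_\Omega\rho$ and $|D|$.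
   Formalization: C_3 and C_3' may depend on max_i sum_k |p_ik|, which can grow with N_y (with only function norms of p_h^xy the bound fails); the variance estimate is stated for p and p_h^y bounded on D x Omega at the time level. *)

theory Defs
  imports "HOL-Probability.Probability"
begin

text \<open>One SFV-cluster discretization. Physical cells, clusters and samples are indexed from 1.
  \<open>coef S n i k\<close> is the value of the scheme in physical cell \<open>i\<close> and cluster \<open>k\<close> at the time
  level \<open>tlev S n\<close>. The samples form one fixed realization.\<close>

record ('x, 'y) sfv =
  Nx :: nat
  cell :: "nat \<Rightarrow> 'x set"
  ctr :: "nat \<Rightarrow> 'x"
  Ny :: nat
  cluster :: "nat \<Rightarrow> 'y set"
  Ns :: nat
  sample :: "nat \<Rightarrow> 'y"
  tlev :: "nat \<Rightarrow> real"
  coef :: "nat \<Rightarrow> nat \<Rightarrow> nat \<Rightarrow> real"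

definition param_measure :: "'y::euclidean_space set \<Rightarrow> ('y \<Rightarrow> real) \<Rightarrow> 'y measure" where
  "param_measure \<Omega> \<rho> = density (lebesgue_on \<Omega>) (\<lambda>y. ennreal (\<rho> y))"

text \<open>Boundedness of the clusters makes their radii meaningful.\<close>

definition sfv_discretization ::
  "'x::euclidean_space set \<Rightarrow> 'y::euclidean_space set \<Rightarrow> ('y \<Rightarrow> real) \<Rightarrow> ('x, 'y) sfv \<Rightarrow> bool" where
  "sfv_discretization D \<Omega> \<rho> S \<longleftrightarrow>
     1 \<le> Nx S \<and> 1 \<le> Ny S \<and> 1 \<le> Ns S \<and>
     (\<forall>i\<in>{1..Nx S}. cell S i \<in> sets lebesgue \<and> ctr S i \<in> cell S i) \<and>
     disjoint_family_on (cell S) {1..Nx S} \<and>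
     (\<Union>i\<in>{1..Nx S}. cell S i) = D \<and>
     (\<forall>k\<in>{1..Ny S}. cluster S k \<in> sets lebesgue \<and> bounded (cluster S k)) \<and>
     (\<forall>j\<in>{1..Ny S}. \<forall>k\<in>{1..Ny S}. j \<noteq> k \<longrightarrow>
        measure (param_measure \<Omega> \<rho>) (cluster S j \<inter> cluster S k) = 0) \<and>
     (\<Union>k\<in>{1..Ny S}. cluster S k) = \<Omega> \<and>
     (\<forall>j\<in>{1..Ns S}. sample S j \<in> \<Omega>)"

definition mesh_size :: "('x::metric_space, 'y) sfv \<Rightarrow> real" where
  "mesh_size S = Max ((\<lambda>i. diameter (cell S i)) ` {1..Nx S})"

text \<open>The radius of a set is that of its smallest enclosing ball.\<close>

definition set_radius :: "'y::metric_space set \<Rightarrow> real" where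
  "set_radius A = Inf {s. 0 \<le> s \<and> (\<exists>a. A \<subseteq> cball a s)}"

definition cluster_size :: "('x, 'y::metric_space) sfv \<Rightarrow> real" where
  "cluster_size S = Max ((\<lambda>k. set_radius (cluster S k)) ` {1..Ny S})"

text \<open>The function on \<open>D \<times> \<Omega>\<close> identified with the coefficients. Clusters may overlap in a null set,
  where the first cluster containing \<open>y\<close> is used.\<close>

definition p_xy :: "('x, 'y) sfv \<Rightarrow> nat \<Rightarrow> 'x \<Rightarrow> 'y \<Rightarrow> real" where
  "p_xy S n x y = coef S n (THE i. i \<in> {1..Nx S} \<and> x \<in> cell S i)
                           (LEAST k. k \<in> {1..Ny S} \<and> y \<in> cluster S k)"

definition mean :: "'y::euclidean_space set \<Rightarrow> ('y \<Rightarrow> real) \<Rightarrow> ('x \<Rightarrow> real \<Rightarrow> 'y \<Rightarrow> real) \<Rightarrow> 'x \<Rightarrow> real \<Rightarrow> real" where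
  "mean \<Omega> \<rho> p x t = (LINT y|lebesgue_on \<Omega>. p x t y * \<rho> y)"

definition var :: "'y::euclidean_space set \<Rightarrow> ('y \<Rightarrow> real) \<Rightarrow> ('x \<Rightarrow> real \<Rightarrow> 'y \<Rightarrow> real) \<Rightarrow> 'x \<Rightarrow> real \<Rightarrow> real" where
  "var \<Omega> \<rho> p x t = mean \<Omega> \<rho> (\<lambda>x t y. (p x t y)\<^sup>2) x t - (mean \<Omega> \<rho> p x t)\<^sup>2"

definition alpha :: "('y::euclidean_space \<Rightarrow> real) \<Rightarrow> ('x, 'y) sfv \<Rightarrow> nat \<Rightarrow> real" where
  "alpha \<rho> S k = (LINT y|lebesgue_on (cluster S k). \<rho> y)"

definition alpha_mc :: "('x, 'y) sfv \<Rightarrow> nat \<Rightarrow> real" where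
  "alpha_mc S k = (\<Sum>j=1..Ns S. indicator (cluster S k) (sample S j)) / real (Ns S)"

definition sigma_k :: "'y::euclidean_space set \<Rightarrow> ('y \<Rightarrow> real) \<Rightarrow> ('x, 'y) sfv \<Rightarrow> nat \<Rightarrow> real" where
  "sigma_k \<Omega> \<rho> S k =
     sqrt (prob_space.variance (param_measure \<Omega> \<rho>) (indicator (cluster S k) :: 'y \<Rightarrow> real))"

definition sigma_max :: "'y::euclidean_space set \<Rightarrow> ('y \<Rightarrow> real) \<Rightarrow> ('x, 'y) sfv \<Rightarrow> real" where
  "sigma_max \<Omega> \<rho> S = Max (sigma_k \<Omega> \<rho> S ` {1..Ny S})"

definition mean_h :: "('x, 'y) sfv \<Rightarrow> nat \<Rightarrow> nat \<Rightarrow> real" where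
  "mean_h S n i = (\<Sum>k=1..Ny S. coef S n i k * alpha_mc S k)"

definition mean_sq_h :: "('x, 'y) sfv \<Rightarrow> nat \<Rightarrow> nat \<Rightarrow> real" where
  "mean_sq_h S n i = (\<Sum>k=1..Ny S. (coef S n i k)\<^sup>2 * alpha_mc S k)"

definition var_h :: "('x, 'y) sfv \<Rightarrow> nat \<Rightarrow> nat \<Rightarrow> real" where
  "var_h S n i = mean_sq_h S n i - (mean_h S n i)\<^sup>2"

text \<open>The norm of \<open>L\<^sup>1(D)\<close>, for a quantity given by its values at the cell centers.\<close>

definition L1_D :: "('x::euclidean_space, 'y) sfv \<Rightarrow> (nat \<Rightarrow> real) \<Rightarrow> real" where
  "L1_D S g = (\<Sum>i=1..Nx S. measure lebesgue (cell S i) * \<bar>g i\<bar>)"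

definition L1_Omega :: "'y::euclidean_space set \<Rightarrow> ('y \<Rightarrow> real) \<Rightarrow> real" where
  "L1_Omega \<Omega> g = (LINT y|lebesgue_on \<Omega>. \<bar>g y\<bar>)"

text \<open>The norms of the solutions on which the constants of the estimates may depend.
  The coefficients enter through their maximum and through the maximum over the physical cells
  of the \<open>\<ell>\<^sup>1\<close> norm over the clusters. The latter governs the sampling error: its bound
  \<open>\<Sum>k. \<bar>coef S n i k\<bar> * \<bar>alpha \<rho> S k - alpha_mc S k\<bar>\<close> has one term per cluster.\<close>

definition bounded_fn :: "'x set \<Rightarrow> 'y set \<Rightarrow> ('x \<Rightarrow> 'y \<Rightarrow> real) \<Rightarrow> bool" where
  "bounded_fn D \<Omega> f \<longleftrightarrow> (\<exists>M. \<forall>x\<in>D. \<forall>y\<in>\<Omega>. \<bar>f x y\<bar> \<le> M)"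

definition sup_norm :: "'x set \<Rightarrow> 'y set \<Rightarrow> ('x \<Rightarrow> 'y \<Rightarrow> real) \<Rightarrow> real" where
  "sup_norm D \<Omega> f = (SUP (x, y)\<in>D \<times> \<Omega>. \<bar>f x y\<bar>)"

definition coef_max :: "('x, 'y) sfv \<Rightarrow> nat \<Rightarrow> real" where
  "coef_max S n = Max ((\<lambda>(i, k). \<bar>coef S n i k\<bar>) ` ({1..Nx S} \<times> {1..Ny S}))"

definition coef_l1 :: "('x, 'y) sfv \<Rightarrow> nat \<Rightarrow> real" where
  "coef_l1 S n = Max ((\<lambda>i. \<Sum>k=1..Ny S. \<bar>coef S n i k\<bar>) ` {1..Nx S})"

text \<open>Existence of the exact mean and of the \<open>L\<^sup>1(\<Omega>)\<close> error. The semi-discrete solution \<open>py\<close> may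
  be any such function, not necessarily constant on each cluster.\<close>

definition admissible ::
  "'x set \<Rightarrow> 'y::euclidean_space set \<Rightarrow> ('y \<Rightarrow> real) \<Rightarrow> real \<Rightarrow>
   ('x \<Rightarrow> real \<Rightarrow> 'y \<Rightarrow> real) \<Rightarrow> ('x \<Rightarrow> real \<Rightarrow> 'y \<Rightarrow> real) \<Rightarrow> bool" where
  "admissible D \<Omega> \<rho> t p py \<longleftrightarrow>
     (\<forall>x\<in>D. p x t \<in> borel_measurable (lebesgue_on \<Omega>) \<and>
            py x t \<in> borel_measurable (lebesgue_on \<Omega>) \<and>
            integrable (lebesgue_on \<Omega>) (\<lambda>y. p x t y * \<rho> y) \<and>
            integrable (lebesgue_on \<Omega>) (\<lambda>y. p x t y - py x t y))"

end

theory Submission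
  imports Defs
begin

text \<open>
  The exact mean and the SFV-cluster mean are joined through two intermediate means: that of the
  semi-discrete solution, and the sum of the coefficients weighted with the exact cluster
  probabilities \<open>\<alpha>\<^sub>k\<close>, which is the mean of the function \<open>p\<^sub>h\<^sup>x\<^sup>y\<close> itself
  (\<open>expectation_step\<close>). The three steps cost the three terms of the estimate.

  \<^item> From \<open>p\<close> to the semi-discrete solution: the density is at most \<open>sup \<rho>\<close>, so the error of the mean
    at each \<open>x\<close> is at most \<open>sup \<rho>\<close> times the \<open>L\<^sup>1(\<Omega>)\<close> error, and summing over the cells of \<open>D\<close>
    contributes \<open>|D|\<close> (\<open>expectation_abs_le\<close>).
  \<^item> From the semi-discrete solution to \<open>p\<^sub>h\<^sup>x\<^sup>y\<close>: exchanging the sum over the cells with the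
    expectation in \<open>y\<close> leaves an average of the \<open>L\<^sup>1(D)\<close> errors, each of which is at most
    \<open>C\<^sub>1 \<Delta>x\<^sup>q\<close>. As the average is over a probability measure, \<open>C\<^sub>1\<close> is unchanged
    (\<open>weighted_mean_error\<close>).
  \<^item> From the weights \<open>\<alpha>\<^sub>k\<close> to the sampled ones: the triangle inequality over the clusters, which
    brings in the \<open>\<ell>\<^sup>1\<close> norm of the coefficients (\<open>sampling_error\<close>).

  The variance is the mean of the square minus the square of the mean. For the former, the same three
  steps apply to the squared functions, where \<open>|u\<^sup>2 - v\<^sup>2| \<le> (|u| + |v|) |u - v|\<close> turns the bounds on the
  functions into factors in the constants; the same inequality reduces the latter to the error of
  the mean.
\<close>

section \<open>Step functions on an almost disjoint cover\<close>

text \<open>The clusters overlap in null sets only, so the value of a step function at a point depends on a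
  choice of cluster, but its expectation does not. The choice of the first cluster is the one that
  identifies the coefficients of the scheme with a function.\<close>

locale null_overlap_cover = prob_space M for M :: "'y measure" +
  fixes K :: nat and \<omega> :: "nat \<Rightarrow> 'y set"
  assumes sets_\<omega>: "k \<in> {1..K} \<Longrightarrow> \<omega> k \<in> events"
    and null_overlap: "\<lbrakk>j \<in> {1..K}; k \<in> {1..K}; j \<noteq> k\<rbrakk> \<Longrightarrow> prob (\<omega> j \<inter> \<omega> k) = 0"
    and cover: "(\<Union>k\<in>{1..K}. \<omega> k) = space M"
begin

definition first_index :: "'y \<Rightarrow> nat" where
  "first_index y = (LEAST k. k \<in> {1..K} \<and> y \<in> \<omega> k)"

lemma first_index:
  assumes "y \<in> space M"
  shows "first_index y \<in> {1..K}" and "y \<in> \<omega> (first_index y)"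
proof -
  from assms cover obtain k where "k \<in> {1..K} \<and> y \<in> \<omega> k" by blast
  then have "first_index y \<in> {1..K} \<and> y \<in> \<omega> (first_index y)"
    unfolding first_index_def by (rule LeastI)
  then show "first_index y \<in> {1..K}" and "y \<in> \<omega> (first_index y)" by auto
qed

lemma measurable_first_index: "first_index \<in> measurable M (count_space UNIV)"
proof -
  have *: "Measurable.pred M (\<lambda>y. k \<in> {1..K} \<and> y \<in> \<omega> k)" for k
  proof (cases "k \<in> {1..K}")
    case True
    have "Measurable.pred M (\<lambda>y. y \<in> \<omega> k)"
      using sets_\<omega>[OF True] by measurable
    with True show ?thesis by (simp only: simp_thms)
  next
    case False
    then show ?thesis by (simp only: simp_thms measurable_const UNIV_I space_count_space)
  qed
  have "(\<lambda>y. LEAST k. k \<in> {1..K} \<and> y \<in> \<omega> k) \<in> measurable M (count_space UNIV)"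
    by (rule measurable_Least[OF *])
  then show ?thesis by (simp only: first_index_def[abs_def])
qed

lemma borel_measurable_step [measurable]:
  "(\<lambda>y. a (first_index y) :: real) \<in> borel_measurable M"
  by (rule measurable_compose[OF measurable_first_index]) simp

lemma integrable_step: "integrable M (\<lambda>y. a (first_index y) :: real)"
proof (rule integrable_const_bound[where B = "\<Sum>k=1..K. \<bar>a k\<bar>"])
  show "AE y in M. norm (a (first_index y)) \<le> (\<Sum>k=1..K. \<bar>a k\<bar>)"
  proof (rule AE_I2)
    fix y assume "y \<in> space M"
    then have "\<bar>a (first_index y)\<bar> \<le> (\<Sum>k=1..K. \<bar>a k\<bar>)"
      by (intro member_le_sum[where f = "\<lambda>k. \<bar>a k\<bar>"] first_index(1)) simp_all
    then show "norm (a (first_index y)) \<le> (\<Sum>k=1..K. \<bar>a k\<bar>)" by simp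
  qed
qed (rule borel_measurable_step)

lemma AE_unique_index:
  "AE y in M. \<forall>j\<in>{1..K}. \<forall>k\<in>{1..K}. j \<noteq> k \<longrightarrow> y \<notin> \<omega> j \<inter> \<omega> k"
proof -
  have "AE y in M. j \<noteq> k \<longrightarrow> y \<notin> \<omega> j \<inter> \<omega> k" if "j \<in> {1..K}" "k \<in> {1..K}" for j k
  proof (cases "j = k")
    case False
    have "\<omega> j \<inter> \<omega> k \<in> null_sets M"
      using sets_\<omega> that null_overlap[OF that False] by (auto simp: null_sets_def emeasure_eq_measure)
    from AE_not_in[OF this] show ?thesis by eventually_elim simp
  qed simp
  then show ?thesis
    by (intro AE_finite_allI finite_atLeastAtMost)
qed

text \<open>Almost every point lies in exactly one of the sets, and there the step function is the
  corresponding combination of indicators.\<close>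

lemma expectation_step:
  "expectation (\<lambda>y. a (first_index y) :: real) = (\<Sum>k=1..K. a k * prob (\<omega> k))"
proof -
  have "AE y in M. a (first_index y) = (\<Sum>k=1..K. a k * indicator (\<omega> k) y)"
    using AE_unique_index AE_space
  proof eventually_elim
    case (elim y)
    have "(\<Sum>k=1..K. a k * indicator (\<omega> k) y)
        = (\<Sum>k=1..K. if k = first_index y then a k else 0)"
      using elim first_index[of y] by (intro sum.cong) (auto simp: indicator_def)
    also have "\<dots> = a (first_index y)"
      using first_index(1)[of y] elim by simp
    finally show ?case ..
  qed
  then have "expectation (\<lambda>y. a (first_index y)) = expectation (\<lambda>y. \<Sum>k=1..K. a k * indicator (\<omega> k) y)"
    using sets_\<omega>
    by (intro integral_cong_AE borel_measurable_step borel_measurable_sum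
        borel_measurable_times borel_measurable_const borel_measurable_indicator)
  also have "\<dots> = (\<Sum>k=1..K. a k * prob (\<omega> k))"
    using sets_\<omega> by (subst Bochner_Integration.integral_sum) (auto simp: emeasure_eq_measure)
  finally show ?thesis .
qed

text \<open>The physical and the parameter variable appear in opposite order in the two hypotheses on the
  error: the first is an expectation for each \<open>i\<close>, the second a weighted sum over \<open>i\<close> for each \<open>y\<close>.
  Linearity exchanges the sum with the expectation, so the second also controls the weighted sum of
  expectations, without a factor for the total weight.\<close>

lemma weighted_mean_error:
  fixes m :: "'i \<Rightarrow> real" and f g :: "'i \<Rightarrow> 'y \<Rightarrow> real" and a :: "'i \<Rightarrow> nat \<Rightarrow> real"
  assumes m: "\<And>i. i \<in> I \<Longrightarrow> 0 \<le> m i"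
    and f: "\<And>i. i \<in> I \<Longrightarrow> integrable M (f i)" and g: "\<And>i. i \<in> I \<Longrightarrow> integrable M (g i)"
    and fg: "\<And>i. i \<in> I \<Longrightarrow> expectation (\<lambda>y. \<bar>f i y - g i y\<bar>) \<le> \<delta>"
    and ga: "\<And>y. y \<in> space M \<Longrightarrow> (\<Sum>i\<in>I. m i * \<bar>g i y - a i (first_index y)\<bar>) \<le> \<epsilon>"
  shows "(\<Sum>i\<in>I. m i * \<bar>expectation (f i) - (\<Sum>k=1..K. a i k * prob (\<omega> k))\<bar>) \<le> \<epsilon> + sum m I * \<delta>"
proof -
  let ?s = "\<lambda>i y. a i (first_index y)"
  have int: "integrable M (\<lambda>y. \<bar>g i y - ?s i y\<bar>)" if "i \<in> I" for i
    using g[OF that] integrable_step by auto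
  have err: "\<bar>expectation (f i) - (\<Sum>k=1..K. a i k * prob (\<omega> k))\<bar>
      \<le> \<delta> + expectation (\<lambda>y. \<bar>g i y - ?s i y\<bar>)" if i: "i \<in> I" for i
  proof -
    have "\<bar>expectation (f i) - (\<Sum>k=1..K. a i k * prob (\<omega> k))\<bar>
        = \<bar>expectation (\<lambda>y. f i y - g i y) + expectation (\<lambda>y. g i y - ?s i y)\<bar>"
      using f[OF i] g[OF i] integrable_step[of "a i"] by (simp add: expectation_step)
    also have "\<dots> \<le> expectation (\<lambda>y. \<bar>f i y - g i y\<bar>) + expectation (\<lambda>y. \<bar>g i y - ?s i y\<bar>)"
      by (intro order_trans[OF abs_triangle_ineq] add_mono integral_abs_bound)
    finally show ?thesis using fg[OF i] by simp
  qed
  have "(\<Sum>i\<in>I. m i * \<bar>expectation (f i) - (\<Sum>k=1..K. a i k * prob (\<omega> k))\<bar>)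
      \<le> (\<Sum>i\<in>I. m i * (\<delta> + expectation (\<lambda>y. \<bar>g i y - ?s i y\<bar>)))"
    using m err by (intro sum_mono mult_left_mono)
  also have "\<dots> = expectation (\<lambda>y. \<Sum>i\<in>I. m i * \<bar>g i y - ?s i y\<bar>) + sum m I * \<delta>"
    using int by (simp add: Bochner_Integration.integral_sum sum.distrib sum_distrib_right ring_distribs)
  also have "expectation (\<lambda>y. \<Sum>i\<in>I. m i * \<bar>g i y - ?s i y\<bar>) \<le> \<epsilon>"
    using int ga by (intro integral_le_const) auto
  finally show ?thesis by simp
qed

end

section \<open>The parameter measure\<close>

locale parameter_density =
  fixes \<Omega> :: "'y::euclidean_space set" and \<rho> :: "'y \<Rightarrow> real"
  assumes sets_\<Omega>: "\<Omega> \<in> sets lebesgue"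
    and measurable_\<rho>: "\<rho> \<in> borel_measurable (lebesgue_on \<Omega>)"
    and \<rho>_nonneg: "y \<in> \<Omega> \<Longrightarrow> 0 \<le> \<rho> y"
    and bdd_\<rho>: "bdd_above (\<rho> ` \<Omega>)"
    and prob: "prob_space (param_measure \<Omega> \<rho>)"
begin

abbreviation P where "P \<equiv> param_measure \<Omega> \<rho>"

sublocale P: prob_space P by (rule prob)

lemma space_P: "space P = \<Omega>" and sets_P: "sets P = sets (lebesgue_on \<Omega>)"
  by (simp_all add: param_measure_def)

lemma measurable_P: "borel_measurable P = borel_measurable (lebesgue_on \<Omega>)"
  by (rule measurable_cong_sets) (simp_all add: sets_P)

lemma AE_\<rho>_nonneg: "AE y in lebesgue_on \<Omega>. 0 \<le> \<rho> y"
  by (rule AE_I2) (simp add: \<rho>_nonneg)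

lemma integrable_P_iff:
  fixes f :: "'y \<Rightarrow> real"
  assumes "f \<in> borel_measurable (lebesgue_on \<Omega>)"
  shows "integrable P f \<longleftrightarrow> integrable (lebesgue_on \<Omega>) (\<lambda>y. f y * \<rho> y)"
  unfolding param_measure_def
  by (subst integrable_density[OF assms measurable_\<rho> AE_\<rho>_nonneg]) (simp add: mult.commute)

lemma expectation_P:
  fixes f :: "'y \<Rightarrow> real"
  assumes "f \<in> borel_measurable (lebesgue_on \<Omega>)"
  shows "P.expectation f = (LINT y|lebesgue_on \<Omega>. f y * \<rho> y)"
  unfolding param_measure_def
  by (subst integral_density[OF assms measurable_\<rho> AE_\<rho>_nonneg]) (simp add: mult.commute)

lemma \<rho>_le_SUP: "y \<in> \<Omega> \<Longrightarrow> \<rho> y \<le> Sup (\<rho> ` \<Omega>)"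
  using bdd_\<rho> by (rule cSUP_upper[rotated])

lemma SUP_\<rho>_nonneg: "0 \<le> Sup (\<rho> ` \<Omega>)"
proof -
  obtain y where "y \<in> \<Omega>" using P.not_empty space_P by auto
  then show ?thesis using \<rho>_nonneg \<rho>_le_SUP by (meson order_trans)
qed

text \<open>The parameter error is measured in the unweighted \<open>L\<^sup>1(\<Omega>)\<close>; boundedness of the density is what
  passes it on to expectations.\<close>

lemma
  fixes f :: "'y \<Rightarrow> real"
  assumes f: "integrable (lebesgue_on \<Omega>) f"
  shows integrable_P: "integrable P f"
    and expectation_abs_le: "P.expectation (\<lambda>y. \<bar>f y\<bar>) \<le> Sup (\<rho> ` \<Omega>) * L1_Omega \<Omega> f"
proof -
  have bound: "\<bar>f y\<bar> * \<rho> y \<le> Sup (\<rho> ` \<Omega>) * \<bar>f y\<bar>" if "y \<in> \<Omega>" for y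
    using mult_left_mono[OF \<rho>_le_SUP[OF that] abs_ge_zero[of "f y"]] by (simp only: mult.commute)
  have meas: "f \<in> borel_measurable (lebesgue_on \<Omega>)" using f by auto
  have "integrable (lebesgue_on \<Omega>) (\<lambda>y. f y * \<rho> y)"
  proof (rule Bochner_Integration.integrable_bound)
    show "integrable (lebesgue_on \<Omega>) (\<lambda>y. Sup (\<rho> ` \<Omega>) * \<bar>f y\<bar>)" using f by auto
    show "(\<lambda>y. f y * \<rho> y) \<in> borel_measurable (lebesgue_on \<Omega>)"
      using meas measurable_\<rho> by measurable
    show "AE y in lebesgue_on \<Omega>. norm (f y * \<rho> y) \<le> norm (Sup (\<rho> ` \<Omega>) * \<bar>f y\<bar>)"
      using bound SUP_\<rho>_nonneg \<rho>_nonneg by (intro AE_I2) (simp add: abs_mult)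
  qed
  then show int: "integrable P f" using integrable_P_iff[OF meas] by simp
  have meas': "(\<lambda>y. \<bar>f y\<bar>) \<in> borel_measurable (lebesgue_on \<Omega>)" using meas by measurable
  have int': "integrable (lebesgue_on \<Omega>) (\<lambda>y. \<bar>f y\<bar> * \<rho> y)"
    using integrable_P_iff[OF meas'] int by auto
  have "P.expectation (\<lambda>y. \<bar>f y\<bar>) = (LINT y|lebesgue_on \<Omega>. \<bar>f y\<bar> * \<rho> y)"
    by (rule expectation_P[OF meas'])
  also have "\<dots> \<le> (LINT y|lebesgue_on \<Omega>. Sup (\<rho> ` \<Omega>) * \<bar>f y\<bar>)"
    using int' f bound by (intro integral_mono) auto
  finally show "P.expectation (\<lambda>y. \<bar>f y\<bar>) \<le> Sup (\<rho> ` \<Omega>) * L1_Omega \<Omega> f"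
    by (simp add: L1_Omega_def)
qed

lemma alpha_eq_prob:
  assumes "cluster S k \<in> sets lebesgue" "cluster S k \<subseteq> \<Omega>"
  shows "alpha \<rho> S k = P.prob (cluster S k)"
proof -
  have set: "cluster S k \<in> sets (lebesgue_on \<Omega>)"
    using assms sets_\<Omega> by (simp add: sets_restrict_space_iff)
  have "P.prob (cluster S k) = P.expectation (indicator (cluster S k))"
    using assms(2) by (simp add: space_P Int_absorb2)
  also have "\<dots> = (LINT y|lebesgue_on \<Omega>. indicator (cluster S k) y * \<rho> y)"
    using set by (intro expectation_P) simp
  also have "\<dots> = (LINT y|lebesgue. indicator (cluster S k) y * \<rho> y)"
    using assms sets_\<Omega>
    by (subst integral_restrict_space) (auto intro!: Bochner_Integration.integral_cong simp: indicator_def)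
  also have "\<dots> = alpha \<rho> S k"
    unfolding alpha_def using assms by (subst integral_restrict_space) auto
  finally show ?thesis ..
qed

end

section \<open>Error of a discretization\<close>

lemma sup_norm_bound:
  assumes "bounded_fn D \<Omega> f" "x \<in> D" "y \<in> \<Omega>"
  shows "\<bar>f x y\<bar> \<le> sup_norm D \<Omega> f"
proof -
  obtain B where "\<forall>x\<in>D. \<forall>y\<in>\<Omega>. \<bar>f x y\<bar> \<le> B" using assms(1) unfolding bounded_fn_def by blast
  then have "bdd_above ((\<lambda>(x, y). \<bar>f x y\<bar>) ` (D \<times> \<Omega>))"
    by (intro bdd_aboveI2[where M = B]) (simp add: mem_Times_iff split_beta)
  from cSUP_upper[OF SigmaI[OF assms(2,3)] this] show ?thesis
    by (simp only: sup_norm_def prod.case)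
qed

lemma abs_sq_diff_le:
  fixes u v :: real
  assumes "\<bar>u\<bar> \<le> A" "\<bar>v\<bar> \<le> B"
  shows "\<bar>u\<^sup>2 - v\<^sup>2\<bar> \<le> (A + B) * \<bar>u - v\<bar>"
proof -
  have "\<bar>u\<^sup>2 - v\<^sup>2\<bar> = \<bar>u + v\<bar> * \<bar>u - v\<bar>"
    by (simp add: power2_eq_square abs_mult[symmetric] algebra_simps)
  also have "\<dots> \<le> (A + B) * \<bar>u - v\<bar>" using assms by (intro mult_right_mono) auto
  finally show ?thesis .
qed

lemma alpha_mc_bounds:
  assumes "1 \<le> Ns S"
  shows "0 \<le> alpha_mc S k" "alpha_mc S k \<le> 1"
proof -
  have "(\<Sum>j=1..Ns S. indicator (cluster S k) (sample S j) :: real) \<le> (\<Sum>j=1..Ns S. 1)"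
    by (intro sum_mono) (simp add: indicator_def)
  then show "alpha_mc S k \<le> 1" using assms by (simp add: alpha_mc_def)
qed (simp add: alpha_mc_def sum_nonneg)

locale discretized = parameter_density \<Omega> \<rho>
  for \<Omega> :: "'y::euclidean_space set" and \<rho> :: "'y \<Rightarrow> real" +
  fixes D :: "'x::euclidean_space set" and S :: "('x, 'y) sfv" and n :: nat
  assumes lmeasurable_D: "D \<in> lmeasurable"
    and sfv: "sfv_discretization D \<Omega> \<rho> S"
begin

lemma
  shows Nx_ge: "1 \<le> Nx S" and Ny_ge: "1 \<le> Ny S" and Ns_ge: "1 \<le> Ns S"
    and cells: "\<And>i. i \<in> {1..Nx S} \<Longrightarrow> cell S i \<in> sets lebesgue"
      "\<And>i. i \<in> {1..Nx S} \<Longrightarrow> ctr S i \<in> cell S i"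
      "disjoint_family_on (cell S) {1..Nx S}" "(\<Union>i\<in>{1..Nx S}. cell S i) = D"
    and clusters: "\<And>k. k \<in> {1..Ny S} \<Longrightarrow> cluster S k \<in> sets lebesgue"
      "\<And>j k. \<lbrakk>j \<in> {1..Ny S}; k \<in> {1..Ny S}; j \<noteq> k\<rbrakk> \<Longrightarrow> P.prob (cluster S j \<inter> cluster S k) = 0"
      "(\<Union>k\<in>{1..Ny S}. cluster S k) = \<Omega>"
  using sfv unfolding sfv_discretization_def by blast+

lemma cluster_subset: "k \<in> {1..Ny S} \<Longrightarrow> cluster S k \<subseteq> \<Omega>"
  using clusters(3) by blast

sublocale P: null_overlap_cover P "Ny S" "cluster S"
proof
  show "cluster S k \<in> P.events" if "k \<in> {1..Ny S}" for k
    using clusters(1) cluster_subset sets_\<Omega> that by (simp add: sets_P sets_restrict_space_iff)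
qed (use clusters(2,3) space_P in simp_all)

lemma prob_cluster: "k \<in> {1..Ny S} \<Longrightarrow> P.prob (cluster S k) = alpha \<rho> S k"
  using clusters(1) cluster_subset by (intro alpha_eq_prob[symmetric])

lemma ctr_in: "i \<in> {1..Nx S} \<Longrightarrow> ctr S i \<in> D"
  using cells(2,4) by blast

lemma p_xy_ctr:
  assumes i: "i \<in> {1..Nx S}"
  shows "p_xy S n (ctr S i) y = coef S n i (P.first_index y)"
proof -
  have "(THE j. j \<in> {1..Nx S} \<and> ctr S i \<in> cell S j) = i"
  proof (rule the_equality)
    fix j assume j: "j \<in> {1..Nx S} \<and> ctr S i \<in> cell S j"
    show "j = i"
    proof (rule ccontr)
      assume "j \<noteq> i"
      then have "cell S j \<inter> cell S i = {}" using cells(3) i j by (simp add: disjoint_family_on_def)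
      then show False using j cells(2)[OF i] by blast
    qed
  qed (use i cells(2) in simp)
  then show ?thesis by (simp add: p_xy_def P.first_index_def)
qed

lemma sum_cells: "(\<Sum>i=1..Nx S. measure lebesgue (cell S i)) = measure lebesgue D"
proof -
  have "cell S i \<in> lmeasurable" if "i \<in> {1..Nx S}" for i
  proof (rule fmeasurableI2[OF lmeasurable_D])
    show "cell S i \<subseteq> D" using cells(4) that by blast
  qed (rule cells(1)[OF that])
  then have "measure lebesgue (\<Union>i\<in>{1..Nx S}. cell S i) = (\<Sum>i=1..Nx S. measure lebesgue (cell S i))"
    using cells(1,3)
    by (intro measure_finite_Union finite_atLeastAtMost image_subsetI)
      (simp_all only: infinity_ennreal_def fmeasurableD2 not_False_eq_True)
  then show ?thesis by (simp only: cells(4))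
qed

lemma L1_D_mono: "(\<And>i. i \<in> {1..Nx S} \<Longrightarrow> \<bar>g i\<bar> \<le> \<bar>h i\<bar>) \<Longrightarrow> L1_D S g \<le> L1_D S h"
  by (auto simp: L1_D_def intro!: sum_mono mult_left_mono)

lemma L1_D_add: "L1_D S (\<lambda>i. g i + h i) \<le> L1_D S g + L1_D S h"
  by (auto simp: L1_D_def sum.distrib[symmetric] distrib_left[symmetric]
      intro!: sum_mono mult_left_mono)

lemma L1_D_scale: "0 \<le> a \<Longrightarrow> L1_D S (\<lambda>i. a * g i) = a * L1_D S g"
  by (simp add: L1_D_def abs_mult sum_distrib_left ac_simps)

lemma L1_D_le_const:
  assumes "\<And>i. i \<in> {1..Nx S} \<Longrightarrow> \<bar>g i\<bar> \<le> b"
  shows "L1_D S g \<le> measure lebesgue D * b"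
proof -
  have "L1_D S g \<le> (\<Sum>i=1..Nx S. measure lebesgue (cell S i) * b)"
    unfolding L1_D_def using assms by (intro sum_mono mult_left_mono) auto
  then show ?thesis by (simp only: sum_distrib_right[symmetric] sum_cells)
qed

lemma coef_le_max: "i \<in> {1..Nx S} \<Longrightarrow> k \<in> {1..Ny S} \<Longrightarrow> \<bar>coef S n i k\<bar> \<le> coef_max S n"
  unfolding coef_max_def
  by (intro Max_ge) (auto intro!: image_eqI[of _ _ "(i, k)"])

lemma coef_l1_ge: "i \<in> {1..Nx S} \<Longrightarrow> (\<Sum>k=1..Ny S. \<bar>coef S n i k\<bar>) \<le> coef_l1 S n"
  unfolding coef_l1_def by (intro Max_ge) auto

text \<open>The intermediate mean, with the coefficients of the scheme but the exact weights.\<close>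

definition mean_alpha :: "(nat \<Rightarrow> nat \<Rightarrow> real) \<Rightarrow> nat \<Rightarrow> real" where
  "mean_alpha a i = (\<Sum>k=1..Ny S. a i k * alpha \<rho> S k)"

lemma expectation_step_eq:
  "P.expectation (\<lambda>y. a i (P.first_index y)) = mean_alpha a i"
  by (simp add: P.expectation_step mean_alpha_def prob_cluster)

text \<open>Both discretization errors at once, for functions \<open>f\<close>, \<open>g\<close> and coefficients \<open>a\<close> that are
  later either the solutions and the coefficients of the scheme or their squares.\<close>

lemma discretization_error:
  fixes f g :: "'x \<Rightarrow> 'y \<Rightarrow> real"
  assumes "\<And>x. x \<in> D \<Longrightarrow> integrable P (f x)" "\<And>x. x \<in> D \<Longrightarrow> integrable P (g x)"
    and "\<And>x. x \<in> D \<Longrightarrow> P.expectation (\<lambda>y. \<bar>f x y - g x y\<bar>) \<le> \<delta>"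
    and "\<And>y. y \<in> \<Omega> \<Longrightarrow> L1_D S (\<lambda>i. g (ctr S i) y - a i (P.first_index y)) \<le> \<epsilon>"
  shows "L1_D S (\<lambda>i. P.expectation (f (ctr S i)) - mean_alpha a i) \<le> \<epsilon> + measure lebesgue D * \<delta>"
proof -
  have "(\<Sum>i=1..Nx S. measure lebesgue (cell S i)
        * \<bar>P.expectation (f (ctr S i)) - (\<Sum>k=1..Ny S. a i k * P.prob (cluster S k))\<bar>)
      \<le> \<epsilon> + (\<Sum>i=1..Nx S. measure lebesgue (cell S i)) * \<delta>"
    by (rule P.weighted_mean_error[where g = "\<lambda>i. g (ctr S i)"])
      (use assms ctr_in in \<open>auto simp: space_P L1_D_def\<close>)
  then show ?thesis
    by (simp only: L1_D_def mean_alpha_def sum_cells prob_cluster cong: sum.cong)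
qed

text \<open>The triangle inequality over the clusters, each standard deviation being replaced by the largest;
  the absolute value of \<open>c\<close> makes that step monotone for a constant of either sign.\<close>

lemma sampling_error:
  assumes "\<forall>k\<in>{1..Ny S}. \<bar>alpha \<rho> S k - alpha_mc S k\<bar> \<le> c * (sigma_k \<Omega> \<rho> S k / sqrt (real (Ns S)))"
  shows "\<bar>mean_alpha a i - (\<Sum>k=1..Ny S. a i k * alpha_mc S k)\<bar>
    \<le> \<bar>c\<bar> * (\<Sum>k=1..Ny S. \<bar>a i k\<bar>) * (sigma_max \<Omega> \<rho> S / sqrt (real (Ns S)))"
proof -
  let ?s = "sigma_max \<Omega> \<rho> S / sqrt (real (Ns S))"
  have weight: "\<bar>alpha \<rho> S k - alpha_mc S k\<bar> \<le> \<bar>c\<bar> * ?s" if k: "k \<in> {1..Ny S}" for k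
  proof -
    have "0 \<le> sigma_k \<Omega> \<rho> S k" by (simp add: sigma_k_def)
    moreover have "sigma_k \<Omega> \<rho> S k \<le> sigma_max \<Omega> \<rho> S"
      unfolding sigma_max_def using k by (intro Max_ge) auto
    ultimately have "c * (sigma_k \<Omega> \<rho> S k / sqrt (real (Ns S))) \<le> \<bar>c\<bar> * ?s"
      by (intro mult_mono divide_right_mono) auto
    then show ?thesis using assms k by force
  qed
  have "\<bar>mean_alpha a i - (\<Sum>k=1..Ny S. a i k * alpha_mc S k)\<bar>
      = \<bar>\<Sum>k=1..Ny S. a i k * (alpha \<rho> S k - alpha_mc S k)\<bar>"
    by (simp add: mean_alpha_def right_diff_distrib sum_subtractf)
  also have "\<dots> \<le> (\<Sum>k=1..Ny S. \<bar>a i k\<bar> * (\<bar>c\<bar> * ?s))"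
    using weight by (intro order_trans[OF sum_abs] sum_mono) (simp only: abs_mult mult_left_mono abs_ge_zero)
  also have "\<dots> = \<bar>c\<bar> * (\<Sum>k=1..Ny S. \<bar>a i k\<bar>) * ?s"
    by (simp only: sum_distrib_left sum_distrib_right mult.assoc mult.left_commute)
  finally show ?thesis .
qed

lemma sigma_max_nonneg: "0 \<le> sigma_max \<Omega> \<rho> S"
proof -
  have "0 \<le> sigma_k \<Omega> \<rho> S 1" by (simp add: sigma_k_def)
  also have "\<dots> \<le> sigma_max \<Omega> \<rho> S"
    unfolding sigma_max_def using Ny_ge by (intro Max_ge) simp_all
  finally show ?thesis .
qed

context
  fixes p py :: "'x \<Rightarrow> real \<Rightarrow> 'y \<Rightarrow> real" and t c \<epsilon> \<delta> :: real
  assumes adm: "admissible D \<Omega> \<rho> t p py"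
    and x_error: "\<forall>y\<in>\<Omega>. L1_D S (\<lambda>i. py (ctr S i) t y - p_xy S n (ctr S i) y) \<le> \<epsilon>"
    and y_error: "\<forall>x\<in>D. L1_Omega \<Omega> (\<lambda>y. p x t y - py x t y) \<le> \<delta>"
    and weight_error:
      "\<forall>k\<in>{1..Ny S}. \<bar>alpha \<rho> S k - alpha_mc S k\<bar> \<le> c * (sigma_k \<Omega> \<rho> S k / sqrt (real (Ns S)))"
begin

lemma meas: "x \<in> D \<Longrightarrow> p x t \<in> borel_measurable (lebesgue_on \<Omega>)"
    "x \<in> D \<Longrightarrow> py x t \<in> borel_measurable (lebesgue_on \<Omega>)"
  using adm by (auto simp: admissible_def)

lemma int_p: "x \<in> D \<Longrightarrow> integrable P (p x t)"
  using adm integrable_P_iff by (auto simp: admissible_def)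

lemma int_diff: "x \<in> D \<Longrightarrow> integrable P (\<lambda>y. p x t y - py x t y)"
  using adm integrable_P by (auto simp: admissible_def)

lemma int_py: "x \<in> D \<Longrightarrow> integrable P (py x t)"
  using Bochner_Integration.integrable_diff[OF int_p int_diff, of x x] by simp

lemma mean_eq: "x \<in> D \<Longrightarrow> mean \<Omega> \<rho> p x t = P.expectation (p x t)"
  using meas expectation_P by (simp add: mean_def)

lemma y_error_P:
  assumes "x \<in> D"
  shows "P.expectation (\<lambda>y. \<bar>p x t y - py x t y\<bar>) \<le> Sup (\<rho> ` \<Omega>) * \<delta>"
proof -
  have "P.expectation (\<lambda>y. \<bar>p x t y - py x t y\<bar>) \<le> Sup (\<rho> ` \<Omega>) * L1_Omega \<Omega> (\<lambda>y. p x t y - py x t y)"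
    using adm assms by (intro expectation_abs_le) (auto simp: admissible_def)
  also have "\<dots> \<le> Sup (\<rho> ` \<Omega>) * \<delta>"
    using y_error assms SUP_\<rho>_nonneg by (intro mult_left_mono) auto
  finally show ?thesis .
qed

lemma x_error_step:
  "y \<in> \<Omega> \<Longrightarrow> L1_D S (\<lambda>i. py (ctr S i) t y - coef S n i (P.first_index y)) \<le> \<epsilon>"
  using x_error by (simp add: L1_D_def p_xy_ctr)

lemma mean_alpha_error:
  "L1_D S (\<lambda>i. mean \<Omega> \<rho> p (ctr S i) t - mean_alpha (coef S n) i)
    \<le> \<epsilon> + measure lebesgue D * (Sup (\<rho> ` \<Omega>) * \<delta>)"
proof -
  have "L1_D S (\<lambda>i. mean \<Omega> \<rho> p (ctr S i) t - mean_alpha (coef S n) i)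
      = L1_D S (\<lambda>i. P.expectation (p (ctr S i) t) - mean_alpha (coef S n) i)"
    by (simp add: L1_D_def mean_eq ctr_in)
  also have "\<dots> \<le> \<epsilon> + measure lebesgue D * (Sup (\<rho> ` \<Omega>) * \<delta>)"
    by (rule discretization_error[where f = "\<lambda>x. p x t" and g = "\<lambda>x. py x t"])
      (use int_p int_py y_error_P x_error_step in auto)
  finally show ?thesis .
qed

lemma mean_sampling_error:
  assumes "i \<in> {1..Nx S}"
  shows "\<bar>mean_alpha (coef S n) i - mean_h S n i\<bar>
    \<le> \<bar>c\<bar> * coef_l1 S n * (sigma_max \<Omega> \<rho> S / sqrt (real (Ns S)))"
  unfolding mean_h_def
  by (rule order_trans[OF sampling_error[OF weight_error]])
    (use coef_l1_ge[OF assms] sigma_max_nonneg in \<open>auto intro!: mult_right_mono mult_left_mono divide_right_mono\<close>)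

theorem mean_error:
  "L1_D S (\<lambda>i. mean \<Omega> \<rho> p (ctr S i) t - mean_h S n i)
    \<le> \<epsilon> + measure lebesgue D * (Sup (\<rho> ` \<Omega>) * \<delta>)
      + measure lebesgue D * (\<bar>c\<bar> * coef_l1 S n * (sigma_max \<Omega> \<rho> S / sqrt (real (Ns S))))"
proof -
  have "L1_D S (\<lambda>i. mean \<Omega> \<rho> p (ctr S i) t - mean_h S n i)
      = L1_D S (\<lambda>i. (mean \<Omega> \<rho> p (ctr S i) t - mean_alpha (coef S n) i)
          + (mean_alpha (coef S n) i - mean_h S n i))"
    by simp
  also have "\<dots> \<le> L1_D S (\<lambda>i. mean \<Omega> \<rho> p (ctr S i) t - mean_alpha (coef S n) i)
      + L1_D S (\<lambda>i. mean_alpha (coef S n) i - mean_h S n i)"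
    by (rule L1_D_add)
  also have "\<dots> \<le> (\<epsilon> + measure lebesgue D * (Sup (\<rho> ` \<Omega>) * \<delta>))
      + measure lebesgue D * (\<bar>c\<bar> * coef_l1 S n * (sigma_max \<Omega> \<rho> S / sqrt (real (Ns S))))"
    by (rule add_mono[OF mean_alpha_error L1_D_le_const[OF mean_sampling_error]])
  finally show ?thesis .
qed

context
  fixes Mp My Mxy L s :: real
  assumes p_le: "\<lbrakk>x \<in> D; y \<in> \<Omega>\<rbrakk> \<Longrightarrow> \<bar>p x t y\<bar> \<le> Mp"
    and py_le: "\<lbrakk>x \<in> D; y \<in> \<Omega>\<rbrakk> \<Longrightarrow> \<bar>py x t y\<bar> \<le> My"
  defines "Mxy \<equiv> coef_max S n" and "L \<equiv> coef_l1 S n"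
    and "s \<equiv> sigma_max \<Omega> \<rho> S / sqrt (real (Ns S))"
begin

lemma bounds_nonneg: "0 \<le> Mp" "0 \<le> My" "0 \<le> Mxy" "0 \<le> L" "0 \<le> s"
proof -
  have one: "1 \<in> {1..Nx S}" "1 \<in> {1..Ny S}" using Nx_ge Ny_ge by simp_all
  obtain y where y: "y \<in> \<Omega>" using P.not_empty space_P by auto
  show "0 \<le> Mp" using p_le[OF ctr_in[OF one(1)] y] by linarith
  show "0 \<le> My" using py_le[OF ctr_in[OF one(1)] y] by linarith
  show "0 \<le> Mxy" using coef_le_max[OF one] unfolding Mxy_def by linarith
  show "0 \<le> L" unfolding L_def
    by (rule order_trans[OF sum_nonneg coef_l1_ge[OF one(1)]]) simp
  show "0 \<le> s" using sigma_max_nonneg by (simp add: s_def)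
qed

lemma int_bounded_sq:
  assumes "f \<in> borel_measurable (lebesgue_on \<Omega>)" "\<And>y. y \<in> \<Omega> \<Longrightarrow> \<bar>f y\<bar> \<le> B"
  shows "integrable P (\<lambda>y. (f y)\<^sup>2 :: real)"
proof (rule P.integrable_const_bound[where B = "B\<^sup>2"])
  show "AE y in P. norm ((f y)\<^sup>2) \<le> B\<^sup>2"
  proof (rule AE_I2)
    fix y assume "y \<in> space P"
    then show "norm ((f y)\<^sup>2) \<le> B\<^sup>2"
      using power_mono[OF assms(2) abs_ge_zero, of y 2] by (simp add: space_P)
  qed
  show "(\<lambda>y. (f y)\<^sup>2) \<in> borel_measurable P" using assms(1) unfolding measurable_P by measurable
qed

lemma square_error:
  "L1_D S (\<lambda>i. mean \<Omega> \<rho> (\<lambda>x t y. (p x t y)\<^sup>2) (ctr S i) t - mean_alpha (\<lambda>i k. (coef S n i k)\<^sup>2) i)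
    \<le> (My + Mxy) * \<epsilon> + measure lebesgue D * ((Mp + My) * (Sup (\<rho> ` \<Omega>) * \<delta>))"
proof -
  have "L1_D S (\<lambda>i. mean \<Omega> \<rho> (\<lambda>x t y. (p x t y)\<^sup>2) (ctr S i) t - mean_alpha (\<lambda>i k. (coef S n i k)\<^sup>2) i)
      = L1_D S (\<lambda>i. P.expectation (\<lambda>y. (p (ctr S i) t y)\<^sup>2) - mean_alpha (\<lambda>i k. (coef S n i k)\<^sup>2) i)"
    using meas(1) by (simp add: L1_D_def ctr_in mean_def expectation_P)
  also have "\<dots> \<le> (My + Mxy) * \<epsilon> + measure lebesgue D * ((Mp + My) * (Sup (\<rho> ` \<Omega>) * \<delta>))"
  proof (rule discretization_error[where f = "\<lambda>x y. (p x t y)\<^sup>2" and g = "\<lambda>x y. (py x t y)\<^sup>2"])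
    fix x assume x: "x \<in> D"
    show i1: "integrable P (\<lambda>y. (p x t y)\<^sup>2)" using meas(1) p_le x by (intro int_bounded_sq)
    show i2: "integrable P (\<lambda>y. (py x t y)\<^sup>2)" using meas(2) py_le x by (intro int_bounded_sq)
    have "P.expectation (\<lambda>y. \<bar>(p x t y)\<^sup>2 - (py x t y)\<^sup>2\<bar>)
        \<le> P.expectation (\<lambda>y. (Mp + My) * \<bar>p x t y - py x t y\<bar>)"
    proof (rule integral_mono)
      show "integrable P (\<lambda>y. \<bar>(p x t y)\<^sup>2 - (py x t y)\<^sup>2\<bar>)"
        using Bochner_Integration.integrable_diff[OF i1 i2] by (rule integrable_abs)
      show "integrable P (\<lambda>y. (Mp + My) * \<bar>p x t y - py x t y\<bar>)"
        using integrable_abs[OF int_diff[OF x]] by simp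
    qed (use x p_le py_le in \<open>auto simp: space_P intro!: abs_sq_diff_le\<close>)
    also have "\<dots> \<le> (Mp + My) * (Sup (\<rho> ` \<Omega>) * \<delta>)"
      using y_error_P[OF x] bounds_nonneg by (simp add: mult_left_mono)
    finally show "P.expectation (\<lambda>y. \<bar>(p x t y)\<^sup>2 - (py x t y)\<^sup>2\<bar>) \<le> (Mp + My) * (Sup (\<rho> ` \<Omega>) * \<delta>)" .
  next
    fix y assume y: "y \<in> \<Omega>"
    have "L1_D S (\<lambda>i. (py (ctr S i) t y)\<^sup>2 - (coef S n i (P.first_index y))\<^sup>2)
        \<le> L1_D S (\<lambda>i. (My + Mxy) * (py (ctr S i) t y - coef S n i (P.first_index y)))"
    proof (rule L1_D_mono)
      fix i assume i: "i \<in> {1..Nx S}"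
      have "\<bar>coef S n i (P.first_index y)\<bar> \<le> Mxy"
        unfolding Mxy_def using P.first_index(1) y by (intro coef_le_max[OF i]) (simp add: space_P)
      then have "\<bar>(py (ctr S i) t y)\<^sup>2 - (coef S n i (P.first_index y))\<^sup>2\<bar>
          \<le> (My + Mxy) * \<bar>py (ctr S i) t y - coef S n i (P.first_index y)\<bar>"
        using py_le[OF ctr_in[OF i] y] by (intro abs_sq_diff_le)
      then show "\<bar>(py (ctr S i) t y)\<^sup>2 - (coef S n i (P.first_index y))\<^sup>2\<bar>
          \<le> \<bar>(My + Mxy) * (py (ctr S i) t y - coef S n i (P.first_index y))\<bar>"
        using bounds_nonneg by (simp add: abs_mult)
    qed
    also have "\<dots> = (My + Mxy) * L1_D S (\<lambda>i. py (ctr S i) t y - coef S n i (P.first_index y))"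
      using bounds_nonneg by (intro L1_D_scale) simp
    also have "\<dots> \<le> (My + Mxy) * \<epsilon>"
      using x_error_step[OF y] bounds_nonneg by (intro mult_left_mono) auto
    finally show "L1_D S (\<lambda>i. (py (ctr S i) t y)\<^sup>2 - (coef S n i (P.first_index y))\<^sup>2) \<le> (My + Mxy) * \<epsilon>" .
  qed
  finally show ?thesis .
qed

lemma abs_mean_alpha_le:
  assumes i: "i \<in> {1..Nx S}"
  shows "\<bar>mean_alpha (coef S n) i\<bar> \<le> Mxy"
proof -
  have "\<bar>mean_alpha (coef S n) i\<bar> \<le> P.expectation (\<lambda>y. \<bar>coef S n i (P.first_index y)\<bar>)"
    unfolding expectation_step_eq[of "coef S n" i, symmetric] by (rule integral_abs_bound)
  also have "\<dots> \<le> Mxy"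
    unfolding Mxy_def using P.first_index(1) i
    by (intro P.integral_le_const integrable_abs P.integrable_step AE_I2 coef_le_max) auto
  finally show ?thesis .
qed

lemma abs_mean_le:
  assumes x: "x \<in> D"
  shows "\<bar>mean \<Omega> \<rho> p x t\<bar> \<le> Mp"
proof -
  have "\<bar>mean \<Omega> \<rho> p x t\<bar> \<le> P.expectation (\<lambda>y. \<bar>p x t y\<bar>)"
    unfolding mean_eq[OF x] by (rule integral_abs_bound)
  also have "\<dots> \<le> Mp"
    using p_le x by (intro P.integral_le_const integrable_abs int_p AE_I2) (auto simp: space_P)
  finally show ?thesis .
qed

text \<open>A sample may lie in an overlap of clusters and is then counted more than once, so the sampled
  weights can add up to more than 1, and \<open>Mxy\<close> need not bound the sampled mean. Each single weight is at
  most 1, which gives the \<open>\<ell>\<^sup>1\<close> norm as a bound instead.\<close>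

lemma abs_mean_h_le:
  assumes i: "i \<in> {1..Nx S}"
  shows "\<bar>mean_h S n i\<bar> \<le> L"
proof -
  have "\<bar>mean_h S n i\<bar> \<le> (\<Sum>k=1..Ny S. \<bar>coef S n i k\<bar>)"
    unfolding mean_h_def using alpha_mc_bounds[OF Ns_ge]
    by (intro order_trans[OF sum_abs] sum_mono) (simp add: abs_mult mult_left_le)
  then show ?thesis using coef_l1_ge[OF i] by (simp add: L_def)
qed

lemma square_sampling_error:
  assumes i: "i \<in> {1..Nx S}"
  shows "\<bar>mean_alpha (\<lambda>i k. (coef S n i k)\<^sup>2) i - mean_sq_h S n i\<bar> \<le> \<bar>c\<bar> * (Mxy * L) * s"
proof -
  have "(\<Sum>k=1..Ny S. \<bar>(coef S n i k)\<^sup>2\<bar>) \<le> (\<Sum>k=1..Ny S. Mxy * \<bar>coef S n i k\<bar>)"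
    unfolding Mxy_def using coef_le_max[OF i]
    by (intro sum_mono) (simp only: power2_eq_square abs_mult mult_right_mono abs_ge_zero)
  also have "\<dots> \<le> Mxy * L"
    unfolding sum_distrib_left[symmetric] L_def
    by (intro mult_left_mono coef_l1_ge i bounds_nonneg)
  finally have "(\<Sum>k=1..Ny S. \<bar>(coef S n i k)\<^sup>2\<bar>) \<le> Mxy * L" .
  then have "\<bar>c\<bar> * (\<Sum>k=1..Ny S. \<bar>(coef S n i k)\<^sup>2\<bar>) * s \<le> \<bar>c\<bar> * (Mxy * L) * s"
    using bounds_nonneg by (intro mult_right_mono mult_left_mono) auto
  then show ?thesis
    using sampling_error[OF weight_error, of "\<lambda>i k. (coef S n i k)\<^sup>2" i]
    unfolding mean_sq_h_def s_def by linarith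
qed

text \<open>The constants of the deterministic terms have to be independent of the \<open>\<ell>\<^sup>1\<close> norm \<open>L\<close>, which is
  the bound at hand for the sampled mean. The difference of the squared means is therefore split at
  the intermediate mean \<open>A\<close>, which is bounded by \<open>Mxy\<close>: the factor involving \<open>L\<close> then multiplies only
  the sampling error.\<close>

theorem variance_error:
  "L1_D S (\<lambda>i. var \<Omega> \<rho> p (ctr S i) t - var_h S n i)
    \<le> (Mp + My + 2 * Mxy) * \<epsilon>
      + measure lebesgue D * Sup (\<rho> ` \<Omega>) * (2 * Mp + My + Mxy) * \<delta>
      + measure lebesgue D * \<bar>c\<bar> * L * (2 * Mxy + L) * s"
proof -
  define E where "E i = mean \<Omega> \<rho> p (ctr S i) t" for i
  define E2 where "E2 i = mean \<Omega> \<rho> (\<lambda>x t y. (p x t y)\<^sup>2) (ctr S i) t" for i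
  define A where "A = mean_alpha (coef S n)"
  define A2 where "A2 = mean_alpha (\<lambda>i k. (coef S n i k)\<^sup>2)"
  have det: "L1_D S (\<lambda>i. (E i)\<^sup>2 - (A i)\<^sup>2) \<le> (Mp + Mxy) * (\<epsilon> + measure lebesgue D * (Sup (\<rho> ` \<Omega>) * \<delta>))"
  proof -
    have "L1_D S (\<lambda>i. (E i)\<^sup>2 - (A i)\<^sup>2) \<le> L1_D S (\<lambda>i. (Mp + Mxy) * (E i - A i))"
    proof (rule L1_D_mono)
      fix i assume i: "i \<in> {1..Nx S}"
      have "\<bar>(E i)\<^sup>2 - (A i)\<^sup>2\<bar> \<le> (Mp + Mxy) * \<bar>E i - A i\<bar>"
        unfolding E_def A_def using i by (intro abs_sq_diff_le abs_mean_le abs_mean_alpha_le ctr_in)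
      then show "\<bar>(E i)\<^sup>2 - (A i)\<^sup>2\<bar> \<le> \<bar>(Mp + Mxy) * (E i - A i)\<bar>"
        using bounds_nonneg by (simp add: abs_mult)
    qed
    also have "\<dots> = (Mp + Mxy) * L1_D S (\<lambda>i. E i - A i)"
      using bounds_nonneg by (intro L1_D_scale) simp
    also have "\<dots> \<le> (Mp + Mxy) * (\<epsilon> + measure lebesgue D * (Sup (\<rho> ` \<Omega>) * \<delta>))"
      unfolding E_def A_def using bounds_nonneg by (intro mult_left_mono mean_alpha_error) simp
    finally show ?thesis .
  qed
  have samp: "\<bar>(A2 i - mean_sq_h S n i) + ((mean_h S n i)\<^sup>2 - (A i)\<^sup>2)\<bar>
      \<le> \<bar>c\<bar> * (Mxy * L) * s + (L + Mxy) * (\<bar>c\<bar> * L * s)" if i: "i \<in> {1..Nx S}" for i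
  proof -
    have "\<bar>(mean_h S n i)\<^sup>2 - (A i)\<^sup>2\<bar> \<le> (L + Mxy) * \<bar>mean_h S n i - A i\<bar>"
      unfolding A_def using i by (intro abs_sq_diff_le abs_mean_h_le abs_mean_alpha_le)
    also have "\<dots> \<le> (L + Mxy) * (\<bar>c\<bar> * L * s)"
      using mean_sampling_error[OF i] bounds_nonneg
      by (intro mult_left_mono) (auto simp: A_def L_def s_def abs_minus_commute)
    finally show ?thesis using square_sampling_error[OF i] unfolding A2_def by linarith
  qed
  have "L1_D S (\<lambda>i. var \<Omega> \<rho> p (ctr S i) t - var_h S n i)
      = L1_D S (\<lambda>i. ((E2 i - A2 i) + ((A2 i - mean_sq_h S n i) + ((mean_h S n i)\<^sup>2 - (A i)\<^sup>2)))
          + - 1 * ((E i)\<^sup>2 - (A i)\<^sup>2))"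
    by (simp add: var_def var_h_def E_def E2_def algebra_simps)
  also have "\<dots> \<le> L1_D S (\<lambda>i. E2 i - A2 i)
      + L1_D S (\<lambda>i. (A2 i - mean_sq_h S n i) + ((mean_h S n i)\<^sup>2 - (A i)\<^sup>2))
      + L1_D S (\<lambda>i. - 1 * ((E i)\<^sup>2 - (A i)\<^sup>2))"
    by (intro order_trans[OF L1_D_add] add_right_mono L1_D_add)
  also have "L1_D S (\<lambda>i. - 1 * ((E i)\<^sup>2 - (A i)\<^sup>2)) = L1_D S (\<lambda>i. (E i)\<^sup>2 - (A i)\<^sup>2)"
    by (simp add: L1_D_def abs_minus_commute)
  also have "L1_D S (\<lambda>i. E2 i - A2 i)
      + L1_D S (\<lambda>i. (A2 i - mean_sq_h S n i) + ((mean_h S n i)\<^sup>2 - (A i)\<^sup>2))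
      + L1_D S (\<lambda>i. (E i)\<^sup>2 - (A i)\<^sup>2)
    \<le> ((My + Mxy) * \<epsilon> + measure lebesgue D * ((Mp + My) * (Sup (\<rho> ` \<Omega>) * \<delta>)))
      + measure lebesgue D * (\<bar>c\<bar> * (Mxy * L) * s + (L + Mxy) * (\<bar>c\<bar> * L * s))
      + (Mp + Mxy) * (\<epsilon> + measure lebesgue D * (Sup (\<rho> ` \<Omega>) * \<delta>))"
    unfolding E2_def A2_def
    by (rule add_mono[OF add_mono[OF square_error L1_D_le_const[OF samp[unfolded A2_def]]] det])
  also have "\<dots> = (Mp + My + 2 * Mxy) * \<epsilon>
      + measure lebesgue D * Sup (\<rho> ` \<Omega>) * (2 * Mp + My + Mxy) * \<delta>
      + measure lebesgue D * \<bar>c\<bar> * L * (2 * Mxy + L) * s"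
    by (simp add: algebra_simps)
  finally show ?thesis .
qed

end

end

end

section \<open>The error estimate\<close>

theorem theorem4p2:
  fixes D :: "'x::euclidean_space set" and \<Omega> :: "'y::euclidean_space set"
    and \<rho> :: "'y \<Rightarrow> real" and q r C1 C2 c :: real
  assumes "D \<in> lmeasurable" and "bounded D"
    and "\<Omega> \<in> sets lebesgue"
    and "\<rho> \<in> borel_measurable (lebesgue_on \<Omega>)"
    and "\<forall>y\<in>\<Omega>. 0 \<le> \<rho> y" and "bdd_above (\<rho> ` \<Omega>)"
    and "prob_space (param_measure \<Omega> \<rho>)"
  shows "\<exists>(C :: real) (C3 :: real \<Rightarrow> real)
      (C1' :: real \<Rightarrow> real \<Rightarrow> real \<Rightarrow> real) (C' :: real \<Rightarrow> real \<Rightarrow> real \<Rightarrow> real)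
      (C3' :: real \<Rightarrow> real \<Rightarrow> real \<Rightarrow> real \<Rightarrow> real).
    \<forall>(S :: ('x, 'y) sfv) (p :: 'x \<Rightarrow> real \<Rightarrow> 'y \<Rightarrow> real) (py :: 'x \<Rightarrow> real \<Rightarrow> 'y \<Rightarrow> real) (n :: nat).
      let t = tlev S n; Mp = sup_norm D \<Omega> (\<lambda>x. p x t); My = sup_norm D \<Omega> (\<lambda>x. py x t);
          Mxy = coef_max S n; L = coef_l1 S n
      in
      sfv_discretization D \<Omega> \<rho> S \<and>
      admissible D \<Omega> \<rho> t p py \<and>
      (\<forall>y\<in>\<Omega>. L1_D S (\<lambda>i. py (ctr S i) t y - p_xy S n (ctr S i) y) \<le> C1 * mesh_size S powr q) \<and>
      (\<forall>x\<in>D. L1_Omega \<Omega> (\<lambda>y. p x t y - py x t y) \<le> C2 * cluster_size S powr r) \<and>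
      (\<forall>k\<in>{1..Ny S}. \<bar>alpha \<rho> S k - alpha_mc S k\<bar> \<le> c * (sigma_k \<Omega> \<rho> S k / sqrt (real (Ns S))))
      \<longrightarrow>
      L1_D S (\<lambda>i. mean \<Omega> \<rho> p (ctr S i) t - mean_h S n i)
        \<le> C1 * mesh_size S powr q + C * cluster_size S powr r
          + C3 L * (sigma_max \<Omega> \<rho> S / sqrt (real (Ns S)))
      \<and>
      (bounded_fn D \<Omega> (\<lambda>x. p x t) \<and> bounded_fn D \<Omega> (\<lambda>x. py x t) \<longrightarrow>
       L1_D S (\<lambda>i. var \<Omega> \<rho> p (ctr S i) t - var_h S n i)
        \<le> C1' Mp My Mxy * mesh_size S powr q + C' Mp My Mxy * cluster_size S powr r
          + C3' Mp My Mxy L * (sigma_max \<Omega> \<rho> S / sqrt (real (Ns S))))"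
proof -
  let ?d = "measure lebesgue D" and ?R = "Sup (\<rho> ` \<Omega>)"
  interpret parameter_density \<Omega> \<rho>
    using assms by (intro parameter_density.intro) blast+
  show ?thesis
  proof (rule exI[of _ "?d * ?R * C2"], rule exI[of _ "\<lambda>L. ?d * \<bar>c\<bar> * L"],
      rule exI[of _ "\<lambda>Mp My Mxy. (Mp + My + 2 * Mxy) * C1"],
      rule exI[of _ "\<lambda>Mp My Mxy. ?d * ?R * (2 * Mp + My + Mxy) * C2"],
      rule exI[of _ "\<lambda>Mp My Mxy L. ?d * \<bar>c\<bar> * L * (2 * Mxy + L)"],
      unfold Let_def, intro allI impI, elim conjE, intro conjI impI)
    fix S :: "('x, 'y) sfv" and p py :: "'x \<Rightarrow> real \<Rightarrow> 'y \<Rightarrow> real" and n :: nat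
    assume sfv: "sfv_discretization D \<Omega> \<rho> S"
      and hyps: "admissible D \<Omega> \<rho> (tlev S n) p py"
        "\<forall>y\<in>\<Omega>. L1_D S (\<lambda>i. py (ctr S i) (tlev S n) y - p_xy S n (ctr S i) y) \<le> C1 * mesh_size S powr q"
        "\<forall>x\<in>D. L1_Omega \<Omega> (\<lambda>y. p x (tlev S n) y - py x (tlev S n) y) \<le> C2 * cluster_size S powr r"
        "\<forall>k\<in>{1..Ny S}. \<bar>alpha \<rho> S k - alpha_mc S k\<bar> \<le> c * (sigma_k \<Omega> \<rho> S k / sqrt (real (Ns S)))"
    interpret discretized \<Omega> \<rho> D S n
      by unfold_locales (rule assms(1), rule sfv)
    show "L1_D S (\<lambda>i. mean \<Omega> \<rho> p (ctr S i) (tlev S n) - mean_h S n i)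
        \<le> C1 * mesh_size S powr q + ?d * ?R * C2 * cluster_size S powr r
          + ?d * \<bar>c\<bar> * coef_l1 S n * (sigma_max \<Omega> \<rho> S / sqrt (real (Ns S)))"
      using mean_error[OF hyps] by (simp only: mult.assoc)
    assume "bounded_fn D \<Omega> (\<lambda>x. p x (tlev S n)) \<and> bounded_fn D \<Omega> (\<lambda>x. py x (tlev S n))"
    then have "L1_D S (\<lambda>i. var \<Omega> \<rho> p (ctr S i) (tlev S n) - var_h S n i)
      \<le> (sup_norm D \<Omega> (\<lambda>x. p x (tlev S n)) + sup_norm D \<Omega> (\<lambda>x. py x (tlev S n)) + 2 * coef_max S n)
          * (C1 * mesh_size S powr q)
        + ?d * ?R * (2 * sup_norm D \<Omega> (\<lambda>x. p x (tlev S n)) + sup_norm D \<Omega> (\<lambda>x. py x (tlev S n)) + coef_max S n)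
          * (C2 * cluster_size S powr r)
        + ?d * \<bar>c\<bar> * coef_l1 S n * (2 * coef_max S n + coef_l1 S n)
          * (sigma_max \<Omega> \<rho> S / sqrt (real (Ns S)))"
      by (intro variance_error[OF hyps] sup_norm_bound[where f = "\<lambda>x. p x (tlev S n)"]
          sup_norm_bound[where f = "\<lambda>x. py x (tlev S n)"]) auto
    then show "L1_D S (\<lambda>i. var \<Omega> \<rho> p (ctr S i) (tlev S n) - var_h S n i)
      \<le> (sup_norm D \<Omega> (\<lambda>x. p x (tlev S n)) + sup_norm D \<Omega> (\<lambda>x. py x (tlev S n)) + 2 * coef_max S n)
          * C1 * mesh_size S powr q
        + ?d * ?R * (2 * sup_norm D \<Omega> (\<lambda>x. p x (tlev S n)) + sup_norm D \<Omega> (\<lambda>x. py x (tlev S n)) + coef_max S n)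
          * C2 * cluster_size S powr r
        + ?d * \<bar>c\<bar> * coef_l1 S n * (2 * coef_max S n + coef_l1 S n)
          * (sigma_max \<Omega> \<rho> S / sqrt (real (Ns S)))"
      by (simp only: mult.assoc)
  qed
qed

end
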